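(* Let $T$ be a tree of order $n \ge 3$. Then $\alpha'(T) + \frac{1}{2}\mathrm{pc}(T) \ge \frac{n}{2}$, with equality if and only if $(T,S) \in \mathcal{T}$ for some labeling $S$ of $T$.
   Context: All graphs are finite and simple. The order of a graph is its number of vertices. The matching number $\alpha'(G)$ of a graph $G$ is the maximum number of edges in a matching (set of pairwise non-adjacent edges) of $G$. A path cover of $G$ is a collection of vertex-disjoint paths (subgraphs of $G$, single vertices allowed) such that every vertex of $G$ belongs to exactly one of the paths; the path covering number $\mathrm{pc}(G)$ is the minimum cardinality of a path cover of $G$. A labeling of a tree $T$ is a weak partition $S = (S_A, S_B, S_C)$ of $V(T)$ (a partition in which some parts may be empty); the pair $(T,S)$ is a labeled tree. The status $\mathrm{sta}(v)$ of a vertex $v$ is the letter $x \in \{A,B,C\}$ with $v \in S_x$. The family $\mathcal{T}$ is the smallest family of labeled trees that (i) contains $(P_3, S_0^* )$, where $P_3$ is the path on three vertices and $S_0^*$ assigns status $A$ to the central vertex and status $B$ to the two leaves; and (ii) is closed under the following four operations, each of which extends a labeled tree $T'$ by attaching a tree to a vertex $v \in V(T')$ (all statuses not mentioned are left unchanged): Operation $\mathcal{O}_1$: let $v$ be a vertex with $\mathrm{sta}(v)=A$. Add a new vertex $u_1$ and the edge $vu_1$; set $\mathrm{sta}(u_1)=B$. Operation $\mathcal{O}_2$: let $v$ be a vertex with $\mathrm{sta}(v)=B$. Add a new path $u_1u_2$ and the edge $vu_1$; change the status of $v$ from $B$ to $C$, and set $\mathrm{sta}(u_1)=A$, $\mathrm{sta}(u_2)=B$.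 Operation $\mathcal{O}_3$: let $v$ be an arbitrary vertex of $T'$. Add a new path $u_1u_2u_3$ and the edge $vu_2$; set $\mathrm{sta}(u_1)=\mathrm{sta}(u_3)=B$ and $\mathrm{sta}(u_2)=A$. Further, if $\mathrm{sta}(v)=B$, change the status of $v$ from $B$ to $C$. Operation $\mathcal{O}_4$: let $v$ be a vertex with $\mathrm{sta}(v)=A$. Add a new path $u_1u_2u_3u_4u_5$ and the edge $vu_3$; set $\mathrm{sta}(u_1)=\mathrm{sta}(u_5)=B$, $\mathrm{sta}(u_2)=\mathrm{sta}(u_4)=A$, and $\mathrm{sta}(u_3)=C$. *)

theory Defs
  imports Complex_Main
begin

text \<open>
  A graph is given by its vertex set \<open>V\<close> and its set \<open>E\<close> of edges, each edge being a two-element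
  set of vertices.
\<close>

definition simple_graph :: "'a set \<Rightarrow> 'a set set \<Rightarrow> bool" where
  "simple_graph V E \<longleftrightarrow> finite V \<and> (\<forall>e\<in>E. e \<subseteq> V \<and> card e = 2)"

text \<open>
  Paths and cycles are given by the list of their distinct vertices in order; a single vertex is
  a path.
\<close>

definition graph_path :: "'a set \<Rightarrow> 'a set set \<Rightarrow> 'a list \<Rightarrow> bool" where
  "graph_path V E xs \<longleftrightarrow>
     xs \<noteq> [] \<and> distinct xs \<and> set xs \<subseteq> V \<and> successively (\<lambda>x y. {x, y} \<in> E) xs"

definition graph_cycle :: "'a set \<Rightarrow> 'a set set \<Rightarrow> 'a list \<Rightarrow> bool" where
  "graph_cycle V E xs \<longleftrightarrow> graph_path V E xs \<and> 3 \<le> length xs \<and> {last xs, hd xs} \<in> E"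

definition graph_connected :: "'a set \<Rightarrow> 'a set set \<Rightarrow> bool" where
  "graph_connected V E \<longleftrightarrow>
     V \<noteq> {} \<and> (\<forall>u\<in>V. \<forall>v\<in>V. \<exists>xs. graph_path V E xs \<and> hd xs = u \<and> last xs = v)"

definition graph_tree :: "'a set \<Rightarrow> 'a set set \<Rightarrow> bool" where
  "graph_tree V E \<longleftrightarrow> simple_graph V E \<and> graph_connected V E \<and> (\<nexists>xs. graph_cycle V E xs)"

definition matching :: "'a set set \<Rightarrow> 'a set set \<Rightarrow> bool" where
  "matching E M \<longleftrightarrow> M \<subseteq> E \<and> pairwise disjnt M"

definition matching_number :: "'a set set \<Rightarrow> nat" where
  "matching_number E = Max (card ` {M. matching E M})"

text \<open>
  A list and its reverse describe the same path, but disjointness prevents a cover from containing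
  both unless they coincide, so counting lists is counting paths.  For finite \<open>V\<close> every path cover
  is finite, since its members are nonempty and disjoint.
\<close>

definition path_cover :: "'a set \<Rightarrow> 'a set set \<Rightarrow> 'a list set \<Rightarrow> bool" where
  "path_cover V E P \<longleftrightarrow>
     (\<forall>p\<in>P. graph_path V E p) \<and>
     (\<forall>p\<in>P. \<forall>q\<in>P. p \<noteq> q \<longrightarrow> set p \<inter> set q = {}) \<and>
     (\<forall>v\<in>V. \<exists>!p. p \<in> P \<and> v \<in> set p)"

definition path_cover_number :: "'a set \<Rightarrow> 'a set set \<Rightarrow> nat" where
  "path_cover_number V E = (LEAST k. \<exists>P. path_cover V E P \<and> card P = k)"

type_synonym 'a labeling = "'a set \<times> 'a set \<times> 'a set"

fun is_labeling :: "'a set \<Rightarrow> 'a labeling \<Rightarrow> bool" where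
  "is_labeling V (SA, SB, SC) \<longleftrightarrow>
     SA \<union> SB \<union> SC = V \<and> SA \<inter> SB = {} \<and> SA \<inter> SC = {} \<and> SB \<inter> SC = {}"

text \<open>
  Elements are \<open>((V, E), (SA, SB, SC))\<close>.  The new vertices of an operation are any distinct
  elements of the vertex type outside \<open>V\<close>, and \<open>base\<close> admits every labeled copy of the
  three-vertex path, so the family contains all isomorphic copies of its members.
\<close>

inductive_set family_T :: "(('a set \<times> 'a set set) \<times> 'a labeling) set" where
  base:
    "distinct [x, c, y] \<Longrightarrow>
     (({x, c, y}, {{x, c}, {c, y}}), ({c}, {x, y}, {})) \<in> family_T"
| O1:
    "\<lbrakk>((V, E), (SA, SB, SC)) \<in> family_T; v \<in> SA; u1 \<notin> V\<rbrakk> \<Longrightarrow>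
     ((V \<union> {u1}, E \<union> {{v, u1}}), (SA, SB \<union> {u1}, SC)) \<in> family_T"
| O2:
    "\<lbrakk>((V, E), (SA, SB, SC)) \<in> family_T; v \<in> SB;
      distinct [u1, u2]; set [u1, u2] \<inter> V = {}\<rbrakk> \<Longrightarrow>
     ((V \<union> {u1, u2}, E \<union> {{v, u1}, {u1, u2}}),
      (SA \<union> {u1}, SB - {v} \<union> {u2}, SC \<union> {v})) \<in> family_T"
| O3:
    "\<lbrakk>((V, E), (SA, SB, SC)) \<in> family_T; v \<in> V;
      distinct [u1, u2, u3]; set [u1, u2, u3] \<inter> V = {}\<rbrakk> \<Longrightarrow>
     ((V \<union> {u1, u2, u3}, E \<union> {{v, u2}, {u1, u2}, {u2, u3}}),
      (SA \<union> {u2}, SB - {v} \<union> {u1, u3}, if v \<in> SB then SC \<union> {v} else SC)) \<in> family_T"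
| O4:
    "\<lbrakk>((V, E), (SA, SB, SC)) \<in> family_T; v \<in> SA;
      distinct [u1, u2, u3, u4, u5]; set [u1, u2, u3, u4, u5] \<inter> V = {}\<rbrakk> \<Longrightarrow>
     ((V \<union> {u1, u2, u3, u4, u5},
       E \<union> {{v, u3}, {u1, u2}, {u2, u3}, {u3, u4}, {u4, u5}}),
      (SA \<union> {u2, u4}, SB \<union> {u1, u5}, SC \<union> {u3})) \<in> family_T"

end

theory Submission
  imports Defs
begin

text \<open>
  Let \<open>A\<close> be a minimum vertex cover of the tree.  By Koenig's theorem, which for forests follows by
  stripping off a leaf together with its neighbour (\<open>forest_vertex_cover\<close>), \<open>A\<close> has as many vertices
  as a maximum matching has edges.  The vertices of a path outside \<open>A\<close> are pairwise non-consecutive,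
  so a path with \<open>k\<close> vertices in \<open>A\<close> has at most \<open>2k + 1\<close> vertices, with equality exactly if it
  alternates, beginning and ending outside \<open>A\<close> (\<open>alternation\<close>).  Summing over a minimum path cover
  gives \<open>n \<le> 2\<alpha>' + pc\<close>.

  In the case of equality every path of the cover alternates.  The edges \<open>F\<close> of these paths form a
  subgraph of maximum degree at most two in which every vertex of \<open>A\<close> has degree two and every edge
  has exactly one end in \<open>A\<close>; moreover \<open>A\<close> covers all edges of the tree (\<open>alternating\<close>).  This
  structure is local: it survives the removal of a branch unless the connecting edge lies in \<open>F\<close>
  and its remaining end lies in \<open>A\<close>.  So the tree can be taken apart at the end of a longest path
  \<open>x0, x1, x2, x3, \<dots>\<close>.  Since \<open>x0\<close> is a leaf, it has at most one edge in \<open>F\<close> and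
  lies outside \<open>A\<close>, so \<open>x1\<close> lies in \<open>A\<close>; all neighbours of \<open>x1\<close> other than \<open>x2\<close> are leaves.
    \<^item> A leaf at \<open>x1\<close> that is not joined to it by \<open>F\<close> comes from \<open>O1\<close>.
    \<^item> Otherwise, if \<open>x1 x2\<close> is not in \<open>F\<close>, then \<open>x1\<close> has exactly two leaves, and \<open>O3\<close> attached the
      three of them.
    \<^item> Otherwise \<open>x1\<close> has degree two, \<open>x1 x2\<close> is in \<open>F\<close> and \<open>x2\<close> is outside \<open>A\<close>.  If \<open>x2\<close> has degree
      one, the tree is the path on three vertices; if it has degree two, \<open>O2\<close> attached \<open>x1\<close> and \<open>x0\<close>.
    \<^item> If \<open>x2\<close> has larger degree, each neighbour of \<open>x2\<close> except \<open>x3\<close> again begins the end of a longest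
      path, so it is in the same situation as \<open>x1\<close>; as \<open>x2\<close> has at most two edges in \<open>F\<close>, there are
      exactly two such neighbours and \<open>x2 x3\<close> is not in \<open>F\<close>: this is \<open>O4\<close>.

  Conversely, along the construction of a member of the family the vertices of status \<open>A\<close> always
  form a vertex cover, and there is a path cover of \<open>n - 2|S_A|\<close> paths; for \<open>O2\<close> one needs that every
  vertex of status \<open>B\<close> is an end of a path.  Hence \<open>2\<alpha>' + pc \<le> n\<close>.
\<close>

section \<open>Paths in trees\<close>

definition nbrs :: "'a set set \<Rightarrow> 'a \<Rightarrow> 'a set" where
  "nbrs E v = {w. {v, w} \<in> E}"

definition induced :: "'a set set \<Rightarrow> 'a set \<Rightarrow> 'a set set" where
  "induced E W = {e \<in> E. e \<subseteq> W}"

definition acyclic_graph :: "'a set \<Rightarrow> 'a set set \<Rightarrow> bool" where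
  "acyclic_graph V E \<longleftrightarrow> (\<nexists>xs. graph_cycle V E xs)"

definition longest_path :: "'a set \<Rightarrow> 'a set set \<Rightarrow> 'a list \<Rightarrow> bool" where
  "longest_path V E xs \<longleftrightarrow>
     graph_path V E xs \<and> (\<forall>ys. graph_path V E ys \<longrightarrow> length ys \<le> length xs)"

lemma edge_ends:
  assumes "simple_graph V E" and "{x, y} \<in> E"
  shows "x \<in> V" and "y \<in> V" and "x \<noteq> y"
  using assms by (fastforce simp: simple_graph_def)+

lemma edge_pair:
  assumes "simple_graph V E" and "e \<in> E"
  obtains x y where "e = {x, y}" and "x \<noteq> y"
  using assms by (auto simp: simple_graph_def card_2_iff)

lemma finite_edges: "simple_graph V E \<Longrightarrow> finite E"
  by (rule finite_subset[of E "Pow V"]) (auto simp: simple_graph_def)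

lemma nbrs_sym: "y \<in> nbrs E x \<longleftrightarrow> x \<in> nbrs E y"
  by (simp add: nbrs_def insert_commute)

lemma nbrs_subset: "simple_graph V E \<Longrightarrow> nbrs E v \<subseteq> V"
  using edge_ends unfolding nbrs_def by fastforce

lemma graph_path_Cons:
  "graph_path V E (x # y # ys) \<longleftrightarrow>
     x \<in> V \<and> x \<notin> set (y # ys) \<and> {x, y} \<in> E \<and> graph_path V E (y # ys)"
  by (auto simp: graph_path_def)

lemma graph_path_prefix: "graph_path V E (xs @ ys) \<Longrightarrow> xs \<noteq> [] \<Longrightarrow> graph_path V E xs"
  by (auto simp: graph_path_def successively_append_iff)

lemma graph_path_subgraph:
  "graph_path V' E' xs \<Longrightarrow> V' \<subseteq> V \<Longrightarrow> E' \<subseteq> E \<Longrightarrow> graph_path V E xs"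
  unfolding graph_path_def by (auto elim: successively_mono)

lemma acyclic_subgraph:
  "acyclic_graph V E \<Longrightarrow> V' \<subseteq> V \<Longrightarrow> E' \<subseteq> E \<Longrightarrow> acyclic_graph V' E'"
  unfolding acyclic_graph_def graph_cycle_def by (meson graph_path_subgraph subsetD)

text \<open>A chord from the first vertex would close a cycle with the segment of the path up to its end.\<close>
lemma no_chord:
  assumes "acyclic_graph V E" and p: "graph_path V E (x # y # ys)" and e: "{x, z} \<in> E"
  shows "z \<notin> set ys"
proof
  assume "z \<in> set ys"
  then obtain as bs where ys: "ys = as @ z # bs" by (meson split_list)
  have "graph_path V E (x # y # as @ [z])"
    using p graph_path_prefix[of V E "x # y # as @ [z]" bs] by (simp add: ys)
  then have "graph_cycle V E (x # y # as @ [z])"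
    using e by (simp add: graph_cycle_def insert_commute)
  with assms(1) show False by (auto simp: acyclic_graph_def)
qed

lemma longest_path_exists:
  assumes "finite V" and "graph_path V E ys"
  obtains xs where "longest_path V E xs" and "length ys \<le> length xs"
proof -
  have "\<forall>zs. graph_path V E zs \<longrightarrow> length zs < Suc (card V)"
    using assms(1) by (auto simp: graph_path_def less_Suc_eq_le
        intro: order_trans[OF eq_refl card_mono] dest: distinct_card[symmetric])
  then obtain xs where "graph_path V E xs" "\<forall>zs. graph_path V E zs \<longrightarrow> length zs \<le> length xs"
    using ex_has_greatest_nat[of "graph_path V E" ys length] assms(2) by metis
  then show ?thesis using that assms(2) by (auto simp: longest_path_def)
qed

text \<open>
  Another neighbour of the first vertex would either prolong the path or be the end of a chord.
\<close>
lemma longest_path_end: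
  assumes "acyclic_graph V E" and "simple_graph V E" and l: "longest_path V E (x # y # ys)"
  shows "nbrs E x = {y}"
proof -
  have p: "graph_path V E (x # y # ys)" using l by (simp add: longest_path_def)
  have "w = y" if w: "{x, w} \<in> E" for w
  proof (rule ccontr)
    assume "w \<noteq> y"
    then have "w \<notin> set (x # y # ys)"
      using no_chord[OF assms(1) p w] edge_ends[OF assms(2) w] by auto
    then have "graph_path V E (w # x # y # ys)"
      using p w edge_ends[OF assms(2) w]
      by (simp add: graph_path_Cons insert_commute)
    then show False using l by (fastforce simp: longest_path_def)
  qed
  then show ?thesis using p by (auto simp: nbrs_def graph_path_Cons)
qed

section \<open>Koenig's theorem for forests\<close>

text \<open>
  The two cardinalities are then equal, since a matching is never larger than a vertex cover.  A leaf
  \<open>x\<close> and its neighbour \<open>y\<close> contribute the edge \<open>{x, y}\<close> to the matching and \<open>y\<close> to the cover;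
  deleting the edges at \<open>y\<close> leaves a forest.
\<close>
lemma forest_vertex_cover:
  assumes "simple_graph V E" and "acyclic_graph V E"
  shows "\<exists>M A. matching E M \<and> A \<subseteq> V \<and> (\<forall>e\<in>E. e \<inter> A \<noteq> {}) \<and> card A \<le> card M"
  using finite_edges[OF assms(1)] assms
proof (induction E rule: finite_psubset_induct)
  case (psubset E)
  show ?case
  proof (cases "E = {}")
    case True
    then show ?thesis by (intro exI[of _ "{}"]) (auto simp: matching_def)
  next
    case False
    then obtain a b where ab: "{a, b} \<in> E" using edge_pair psubset.prems(1) by (metis all_not_in_conv)
    have "graph_path V E [a, b]"
      using ab edge_ends[OF psubset.prems(1) ab] by (auto simp: graph_path_def)
    moreover have "finite V" using psubset.prems(1) by (simp add: simple_graph_def)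
    ultimately obtain xs where xs: "longest_path V E xs" "length [a, b] \<le> length xs"
      using longest_path_exists by blast
    then obtain x y ys where "xs = x # y # ys" by (cases xs; cases "tl xs") auto
    with xs(1) have nb: "nbrs E x = {y}"
      using longest_path_end[OF psubset.prems(2,1)] by simp
    then have xy: "{x, y} \<in> E" by (auto simp: nbrs_def)
    \<comment> \<open>Only edges are deleted; \<open>y\<close> stays behind as an isolated vertex.\<close>
    define E' where "E' = {e \<in> E. y \<notin> e}"
    have "E' \<subseteq> E" "{x, y} \<notin> E'" by (auto simp: E'_def)
    with xy have sub: "E' \<subset> E" by (metis psubsetI)
    have "simple_graph V E'" using psubset.prems(1) by (auto simp: simple_graph_def E'_def)
    moreover have "acyclic_graph V E'"
      using psubset.prems(2) by (rule acyclic_subgraph) (auto simp: E'_def)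
    ultimately have "\<exists>M A. matching E' M \<and> A \<subseteq> V \<and> (\<forall>e\<in>E'. e \<inter> A \<noteq> {}) \<and> card A \<le> card M"
      by (rule psubset.IH[OF sub])
    then obtain M A where IH: "matching E' M" "A \<subseteq> V" "\<forall>e\<in>E'. e \<inter> A \<noteq> {}" "card A \<le> card M"
      by (elim exE conjE)
    have x: "x \<notin> e" if "e \<in> E'" for e
    proof
      assume "x \<in> e"
      moreover have "e \<in> E" using that by (simp add: E'_def)
      then obtain c d where "e = {c, d}" by (rule edge_pair[OF psubset.prems(1)])
      ultimately have "\<exists>w. e = {x, w}" by auto
      then show False using nb that by (auto simp: nbrs_def E'_def)
    qed
    have M: "M \<subseteq> E'" "pairwise disjnt M" using IH(1) by (auto simp: matching_def)
    have "matching E (insert {x, y} M)"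
      using M x xy sub unfolding matching_def pairwise_insert
      by (auto simp: disjnt_def E'_def)
    moreover have "insert y A \<subseteq> V" using IH(2) edge_ends[OF psubset.prems(1) xy] by auto
    moreover have "\<forall>e\<in>E. e \<inter> insert y A \<noteq> {}" using IH(3) by (auto simp: E'_def)
    moreover have "card (insert y A) \<le> card (insert {x, y} M)"
    proof -
      have "finite M" using M(1) sub psubset.hyps(1) by (meson finite_subset psubset_imp_subset)
      moreover have "{x, y} \<notin> M" using M(1) by (auto simp: E'_def)
      moreover have "card (insert y A) \<le> Suc (card A)" by (rule card_insert_le_m1) auto
      ultimately show ?thesis using IH(4) by simp
    qed
    ultimately show ?thesis by blast
  qed
qed

lemma matchings_finite: "simple_graph V E \<Longrightarrow> finite {M. matching E M}"
  by (rule finite_subset[of _ "Pow E"]) (auto simp: matching_def finite_edges)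

lemma matching_le: "simple_graph V E \<Longrightarrow> matching E M \<Longrightarrow> card M \<le> matching_number E"
  unfolding matching_number_def by (rule Max_ge) (auto simp: matchings_finite)

text \<open>Disjoint edges pick distinct vertices from the cover.\<close>
lemma matching_number_le_cover:
  assumes "simple_graph V E" and "finite A" and cov: "\<forall>e\<in>E. e \<inter> A \<noteq> {}"
  shows "matching_number E \<le> card A"
proof -
  have "card M \<le> card A" if M: "matching E M" for M
  proof -
    define f where "f e = (SOME a. a \<in> e \<inter> A)" for e
    have f: "f e \<in> e \<inter> A" if "e \<in> M" for e
      using M cov that unfolding f_def matching_def by (metis some_in_eq subsetD)
    have "inj_on f M"
      using M f unfolding inj_on_def matching_def pairwise_def disjnt_def by (metis IntD1 IntI empty_iff)
    moreover have "f ` M \<subseteq> A" using f by auto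
    ultimately show ?thesis using assms(2) card_inj_on_le by blast
  qed
  moreover have "matching E {}" by (simp add: matching_def)
  ultimately show ?thesis
    unfolding matching_number_def using matchings_finite[OF assms(1)] by (subst Max_le_iff) auto
qed

section \<open>Path covers against a vertex cover\<close>

text \<open>
  Positions count from \<open>0\<close>, so the extremal paths have their covered vertices at the odd positions.
  Of the first two vertices at least one lies in \<open>A\<close>.  In the case of equality exactly one does, and
  it is the second one: by induction the rest of the path begins outside \<open>A\<close>, so its
  predecessor has to cover the edge between them.
\<close>
lemma alternation:
  assumes "successively (\<lambda>x y. x \<in> A \<or> y \<in> A) p" and "distinct p"
  shows "length p \<le> 2 * card (set p \<inter> A) + 1 \<and>
    (length p = 2 * card (set p \<inter> A) + 1 \<longrightarrow> odd (length p) \<and> (\<forall>i<length p. p ! i \<in> A \<longleftrightarrow> odd i))"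
  using assms
proof (induction p rule: induct_list012)
  case (3 x y zs)
  have suc: "successively (\<lambda>x y. x \<in> A \<or> y \<in> A) zs" and xy: "x \<in> A \<or> y \<in> A"
    using "3.prems" by (auto simp: successively_Cons)
  have IH: "length zs \<le> 2 * card (set zs \<inter> A) + 1"
    "length zs = 2 * card (set zs \<inter> A) + 1 \<Longrightarrow>
       odd (length zs) \<and> (\<forall>i<length zs. zs ! i \<in> A \<longleftrightarrow> odd i)"
    using "3.IH"(1)[OF suc] "3.prems" by auto
  have c: "card (set (x # y # zs) \<inter> A) =
      (if x \<in> A then 1 else 0) + (if y \<in> A then 1 else 0) + card (set zs \<inter> A)"
    using "3.prems" by (auto simp: Int_insert_left)
  show ?case
  proof (intro conjI impI)
    show "length (x # y # zs) \<le> 2 * card (set (x # y # zs) \<inter> A) + 1"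
      using xy IH(1) unfolding c by auto
    assume eq: "length (x # y # zs) = 2 * card (set (x # y # zs) \<inter> A) + 1"
    have zs: "odd (length zs)" "\<forall>i<length zs. zs ! i \<in> A \<longleftrightarrow> odd i"
      using IH xy eq unfolding c by (auto split: if_splits)
    then have "zs \<noteq> []" by auto
    with zs(2) have "hd zs \<notin> A" by (simp add: hd_conv_nth)
    with \<open>zs \<noteq> []\<close> have y: "y \<in> A" using "3.prems"(1) by (cases zs) auto
    then have x: "x \<notin> A" using eq IH(1) unfolding c by (auto split: if_splits)
    show "odd (length (x # y # zs))" using zs by simp
    show "\<forall>i<length (x # y # zs). (x # y # zs) ! i \<in> A \<longleftrightarrow> odd i"
    proof (intro allI impI)
      fix i assume "i < length (x # y # zs)"
      then show "(x # y # zs) ! i \<in> A \<longleftrightarrow> odd i"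
        using x y zs(2) by (cases i; cases "i - 1") auto
    qed
  qed
qed auto

lemma path_cover_card:
  assumes "simple_graph V E" and P: "path_cover V E P"
  shows "finite P" and "A \<subseteq> V \<Longrightarrow> card A = (\<Sum>p\<in>P. card (set p \<inter> A))"
proof -
  have fV: "finite V" using assms(1) by (simp add: simple_graph_def)
  have ne: "set p \<noteq> {}" "set p \<subseteq> V" if "p \<in> P" for p
    using P that by (auto simp: path_cover_def graph_path_def)
  have disj: "set p \<inter> set q = {}" if "p \<in> P" "q \<in> P" "p \<noteq> q" for p q
    using P that by (auto simp: path_cover_def)
  have "inj_on set P" using ne disj by (metis (no_types) inj_onI inf.idem)
  moreover have "finite (set ` P)" using ne(2) by (intro finite_subset[OF _ finite_Pow_iff[THEN iffD2, OF fV]]) auto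
  ultimately show fP: "finite P" by (rule finite_imageD[rotated])
  assume A: "A \<subseteq> V"
  have "A = (\<Union>p\<in>P. set p \<inter> A)" using P A by (auto simp: path_cover_def)
  also have "card \<dots> = (\<Sum>p\<in>P. card (set p \<inter> A))"
    by (rule card_UN_disjoint) (use fP disj in auto)
  finally show "card A = (\<Sum>p\<in>P. card (set p \<inter> A))" .
qed

text \<open>
  The bounds of \<open>alternation\<close> for the single paths add up, and equality of the sums forces equality
  for each path.
\<close>
lemma path_cover_bound:
  assumes "simple_graph V E" and P: "path_cover V E P"
    and A: "A \<subseteq> V" and cov: "\<forall>e\<in>E. e \<inter> A \<noteq> {}"
  shows "card V \<le> 2 * card A + card P"
    and "card V = 2 * card A + card P \<Longrightarrow> p \<in> P \<Longrightarrow>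
      odd (length p) \<and> (\<forall>i<length p. p ! i \<in> A \<longleftrightarrow> odd i)"
proof -
  note fP = path_cover_card(1)[OF assms(1,2)]
  have p: "distinct q" "set q \<subseteq> V" "successively (\<lambda>x y. x \<in> A \<or> y \<in> A) q" if "q \<in> P" for q
  proof -
    have q: "graph_path V E q" using P that by (simp add: path_cover_def)
    then show "distinct q" "set q \<subseteq> V" by (auto simp: graph_path_def)
    have "x \<in> A \<or> y \<in> A" if "{x, y} \<in> E" for x y using cov that by fastforce
    then show "successively (\<lambda>x y. x \<in> A \<or> y \<in> A) q"
      using q unfolding graph_path_def by (elim conjE successively_mono)
  qed
  have V: "card V = (\<Sum>p\<in>P. length p)"
    using path_cover_card(2)[OF assms(1,2), of V] p by (simp add: Int_absorb2 distinct_card)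
  have R: "2 * card A + card P = (\<Sum>p\<in>P. 2 * card (set p \<inter> A) + 1)"
    using path_cover_card(2)[OF assms(1,2) A]
    by (simp only: sum.distrib sum_distrib_left[symmetric]) simp
  have le: "length q \<le> 2 * card (set q \<inter> A) + 1" if "q \<in> P" for q
    using alternation[OF p(3,1)] that by blast
  show "card V \<le> 2 * card A + card P" unfolding V R using le by (rule sum_mono)
  assume "card V = 2 * card A + card P" and pP: "p \<in> P"
  then have "length p = 2 * card (set p \<inter> A) + 1"
    unfolding V R using le fP by (metis (no_types, lifting) sum_mono_inv)
  then show "odd (length p) \<and> (\<forall>i<length p. p ! i \<in> A \<longleftrightarrow> odd i)"
    using alternation[OF p(3,1)] pP by blast
qed

lemma path_cover_number_attained:
  obtains P where "path_cover V E P" and "card P = path_cover_number V E"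
proof -
  have "path_cover V E ((\<lambda>v. [v]) ` V)"
    by (auto simp: path_cover_def graph_path_def)
  then have "\<exists>k P. path_cover V E P \<and> card P = k" by blast
  then have "\<exists>P. path_cover V E P \<and> card P = path_cover_number V E"
    unfolding path_cover_number_def by (rule LeastI_ex)
  then show ?thesis using that by blast
qed

lemma path_cover_number_le: "path_cover V E P \<Longrightarrow> path_cover_number V E \<le> card P"
  unfolding path_cover_number_def by (rule Least_le) blast

section \<open>The alternating structure of an extremal tree\<close>

text \<open>
  The paths of an extremal cover are recorded only by the set \<open>F\<close> of their edges and by local
  conditions on \<open>F\<close>, so that restricting the structure to a part of the tree does not require cutting
  paths into pieces.
\<close>
definition alternating :: "'a set \<Rightarrow> 'a set set \<Rightarrow> 'a set \<Rightarrow> 'a set set \<Rightarrow> bool" where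
  "alternating V E A F \<longleftrightarrow>
     A \<subseteq> V \<and> (\<forall>e\<in>E. e \<inter> A \<noteq> {}) \<and> F \<subseteq> E \<and>
     (\<forall>x y. {x, y} \<in> F \<longrightarrow> x \<in> A \<longrightarrow> y \<notin> A) \<and>
     (\<forall>a\<in>A. card (nbrs F a) = 2) \<and> (\<forall>v. card (nbrs F v) \<le> 2)"

text \<open>
  The neighbours of \<open>p ! i\<close> in \<open>F\<close> are its neighbours on \<open>p\<close>, as no other path of the cover meets
  \<open>p ! i\<close>.  A vertex of \<open>A\<close> is at an odd position of a path of odd length, hence never at an end.
\<close>
lemma path_cover_alternating:
  assumes sg: "simple_graph V E" and P: "path_cover V E P"
    and A: "A \<subseteq> V" and cov: "\<forall>e\<in>E. e \<inter> A \<noteq> {}"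
    and eq: "card V = 2 * card A + card P"
  shows "\<exists>F. alternating V E A F"
proof -
  define F where "F = {{p ! i, p ! Suc i} |p i. p \<in> P \<and> Suc i < length p}"
  have alt: "odd (length p)" "i < length p \<Longrightarrow> p ! i \<in> A \<longleftrightarrow> odd i" if "p \<in> P" for p i
    using path_cover_bound(2)[OF sg P A cov eq that] by auto
  have dist: "distinct p" and path: "graph_path V E p" if "p \<in> P" for p
    using P that by (auto simp: path_cover_def graph_path_def)
  have uniq: "p = q" if "p \<in> P" "q \<in> P" "i < length p" "j < length q" "p ! i = q ! j" for p q i j
    using P that unfolding path_cover_def by (metis disjoint_iff nth_mem)
  have nb: "nbrs F (p ! i) = {p ! j |j. j < length p \<and> (j = Suc i \<or> i = Suc j)}"
    if p: "p \<in> P" and i: "i < length p" for p i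
  proof (intro set_eqI iffI)
    fix w assume "w \<in> nbrs F (p ! i)"
    then obtain q j where q: "q \<in> P" "Suc j < length q" "{p ! i, w} = {q ! j, q ! Suc j}"
      unfolding nbrs_def F_def by blast
    then consider "p ! i = q ! j" "w = q ! Suc j" | "p ! i = q ! Suc j" "w = q ! j"
      by (auto simp: doubleton_eq_iff)
    then show "w \<in> {p ! j |j. j < length p \<and> (j = Suc i \<or> i = Suc j)}"
    proof cases
      case 1
      with uniq[OF p q(1) i, of j] q have "q = p" by auto
      with 1 q i dist[OF p] have "i = j" by (simp add: nth_eq_iff_index_eq)
      with 1 q \<open>q = p\<close> show ?thesis by blast
    next
      case 2
      with uniq[OF p q(1) i, of "Suc j"] q have "q = p" by auto
      with 2 q i dist[OF p] have "i = Suc j" by (simp add: nth_eq_iff_index_eq)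
      with 2 q \<open>q = p\<close> show ?thesis by auto
    qed
  next
    fix w assume "w \<in> {p ! j |j. j < length p \<and> (j = Suc i \<or> i = Suc j)}"
    then show "w \<in> nbrs F (p ! i)"
      using p i unfolding nbrs_def F_def by (auto simp: insert_commute)
  qed
  have at: "\<exists>p i. p \<in> P \<and> i < length p \<and> v = p ! i" if "v \<in> V" for v
    using P that unfolding path_cover_def by (metis in_set_conv_nth)
  have FE: "F \<subseteq> E"
  proof
    fix e assume "e \<in> F"
    then obtain p i where "e = {p ! i, p ! Suc i}" "p \<in> P" "Suc i < length p" by (auto simp: F_def)
    then show "e \<in> E" using path[of p] by (auto simp: graph_path_def successively_conv_nth)
  qed
  have "y \<notin> A" if xy: "{x, y} \<in> F" and x: "x \<in> A" for x y
  proof -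
    obtain p i where p: "p \<in> P" "i < length p" "x = p ! i" using at A x by blast
    then have "y \<in> nbrs F (p ! i)" using xy by (simp add: nbrs_def)
    then obtain j where "y = p ! j" "j < length p" "j = Suc i \<or> i = Suc j" using nb[OF p(1,2)] by auto
    then show ?thesis using alt(2)[OF p(1)] p x by auto
  qed
  moreover have "card (nbrs F a) = 2" if a: "a \<in> A" for a
  proof -
    obtain p i where p: "p \<in> P" "i < length p" "a = p ! i" using at A a by blast
    then have "odd i" using alt(2) a by blast
    then have i: "0 < i" "Suc i < length p"
      using alt(1)[OF p(1)] p(2) by (auto elim: oddE) (metis Suc_lessI even_Suc)
    then have "nbrs F a = {p ! (i - 1), p ! Suc i}"
      unfolding p(3) nb[OF p(1,2)] by auto
    moreover have "p ! (i - 1) \<noteq> p ! Suc i"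
      using dist[OF p(1)] i by (simp add: nth_eq_iff_index_eq)
    ultimately show ?thesis by simp
  qed
  moreover have "card (nbrs F v) \<le> 2" for v
  proof (cases "v \<in> V")
    case True
    then obtain p i where p: "p \<in> P" "i < length p" "v = p ! i" using at by blast
    then have "nbrs F v \<subseteq> {p ! (i - 1), p ! Suc i}" unfolding p(3) nb[OF p(1,2)] by auto
    then have "card (nbrs F v) \<le> card {p ! (i - 1), p ! Suc i}" by (rule card_mono[rotated]) simp
    also have "\<dots> \<le> 2" by (simp add: card_insert_if)
    finally show ?thesis .
  next
    case False
    then have "nbrs F v = {}" using FE edge_ends[OF sg] by (fastforce simp: nbrs_def)
    then show ?thesis by simp
  qed
  ultimately show ?thesis using A cov FE unfolding alternating_def by blast
qed

section \<open>Pruning a tree\<close>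

lemma path_from_closed:
  assumes "graph_path V E xs" and "hd xs \<in> W" and "\<And>x y. {x, y} \<in> E \<Longrightarrow> x \<in> W \<Longrightarrow> y \<in> W"
  shows "set xs \<subseteq> W"
  using assms(1,2)
proof (induction xs rule: induct_list012)
  case (3 x y zs)
  then show ?case using assms(3) by (auto simp: graph_path_Cons)
qed auto

text \<open>Used to recognise the whole tree, and in \<open>connected_nbr\<close> to find further edges.\<close>
lemma connected_closed:
  assumes "graph_connected V E" and "u \<in> V" and "u \<in> W"
    and "\<And>x y. {x, y} \<in> E \<Longrightarrow> x \<in> W \<Longrightarrow> y \<in> W"
  shows "V \<subseteq> W"
proof
  fix v assume "v \<in> V"
  then obtain xs where xs: "graph_path V E xs" "hd xs = u" "last xs = v"
    using assms(1,2) by (auto simp: graph_connected_def)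
  then have "set xs \<subseteq> W" using path_from_closed assms(3,4) by metis
  moreover have "xs \<noteq> []" using xs(1) by (simp add: graph_path_def)
  ultimately show "v \<in> W" using xs(3) by auto
qed

lemma connected_nbr:
  assumes "graph_connected V E" and "v \<in> V" and "w \<in> V" and "v \<noteq> w"
  shows "nbrs E v \<noteq> {}"
proof
  assume "nbrs E v = {}"
  then have "V \<subseteq> {v}" using assms(1,2) by (intro connected_closed[of V E v]) (auto simp: nbrs_def)
  then show False using assms(3,4) by auto
qed

text \<open>
  In the next three lemmas \<open>v\<close> is the only vertex of \<open>V'\<close> with neighbours outside \<open>V'\<close>.  A path that
  leaves \<open>V'\<close> and returns to it would pass through \<open>v\<close> twice, so \<open>V'\<close> stays connected when
  the rest of the tree is removed.
\<close>
lemma path_enters: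
  assumes "graph_path V E xs" and "hd xs \<notin> V'" and "last xs \<in> V'"
    and cross: "\<And>x y. {x, y} \<in> E \<Longrightarrow> x \<in> V' \<Longrightarrow> y \<notin> V' \<Longrightarrow> x = v"
  shows "v \<in> set xs"
  using assms(1-3)
proof (induction xs rule: induct_list012)
  case (3 x y zs)
  then show ?case using cross[of y x] by (cases "y \<in> V'") (auto simp: graph_path_Cons insert_commute)
qed (auto simp: graph_path_def)

lemma path_stays:
  assumes "graph_path V E xs" and "hd xs \<in> V'" and "last xs \<in> V'"
    and cross: "\<And>x y. {x, y} \<in> E \<Longrightarrow> x \<in> V' \<Longrightarrow> y \<notin> V' \<Longrightarrow> x = v"
  shows "set xs \<subseteq> V'"
  using assms(1-3)
proof (induction xs rule: induct_list012)
  case (3 x y zs)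
  have p: "graph_path V E (y # zs)" "{x, y} \<in> E" "x \<notin> set (y # zs)" "x \<in> V'" "last (y # zs) \<in> V'"
    using "3.prems" by (auto simp: graph_path_Cons)
  have "y \<in> V'"
  proof (rule ccontr)
    assume "y \<notin> V'"
    then have "v \<in> set (y # zs)" using path_enters[OF p(1) _ p(5) cross] by simp
    moreover have "x = v" using cross[OF p(2,4)] \<open>y \<notin> V'\<close> .
    ultimately show False using p(3) by simp
  qed
  then show ?case using "3.IH"(2)[OF p(1)] p by simp
qed (auto simp: graph_path_def)

lemma tree_prune:
  assumes T: "graph_tree V E" and "V' \<subseteq> V" and "v \<in> V'"
    and cross: "\<And>x y. {x, y} \<in> E \<Longrightarrow> x \<in> V' \<Longrightarrow> y \<notin> V' \<Longrightarrow> x = v"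
  shows "graph_tree V' (induced E V')"
  unfolding graph_tree_def
proof (intro conjI)
  show "simple_graph V' (induced E V')"
    using T finite_subset[OF assms(2)] by (auto simp: graph_tree_def simple_graph_def induced_def)
  show "\<nexists>xs. graph_cycle V' (induced E V') xs"
    using T acyclic_subgraph[OF _ assms(2), of E "induced E V'"]
    by (simp add: graph_tree_def acyclic_graph_def induced_def)
  show "graph_connected V' (induced E V')"
    unfolding graph_connected_def
  proof (intro conjI ballI)
    show "V' \<noteq> {}" using assms(3) by auto
    fix a b assume ab: "a \<in> V'" "b \<in> V'"
    then obtain xs where xs: "graph_path V E xs" "hd xs = a" "last xs = b"
      using T assms(2) unfolding graph_tree_def graph_connected_def by (meson subsetD)
    then have in': "set xs \<subseteq> V'" using path_stays[OF xs(1) _ _ cross] ab by simp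
    then have "graph_path V' (induced E V') xs"
      using xs(1) unfolding graph_path_def induced_def by (auto elim!: successively_mono)
    then show "\<exists>xs. graph_path V' (induced E V') xs \<and> hd xs = a \<and> last xs = b" using xs by blast
  qed
qed

lemma edges_split:
  assumes "simple_graph V E"
  shows "E = induced E (V - W) \<union> (\<Union>w\<in>W. (\<lambda>x. {w, x}) ` nbrs E w)"
proof (intro set_eqI iffI)
  fix e assume e: "e \<in> E"
  then obtain x y where xy: "e = {x, y}" by (rule edge_pair[OF assms])
  with e have V: "x \<in> V" "y \<in> V" using edge_ends[OF assms] by auto
  show "e \<in> induced E (V - W) \<union> (\<Union>w\<in>W. (\<lambda>x. {w, x}) ` nbrs E w)"
  proof (cases "x \<in> W")
    case True
    then show ?thesis using e unfolding xy nbrs_def by blast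
  next
    case x: False
    show ?thesis
    proof (cases "y \<in> W")
      case True
      moreover have "e = {y, x}" using xy by auto
      ultimately show ?thesis using e unfolding nbrs_def by blast
    next
      case False
      then show ?thesis using e V x unfolding xy induced_def by blast
    qed
  qed
qed (auto simp: induced_def nbrs_def)

text \<open>
  The status \<open>B\<close> of a leaf is needed for attaching a path to it by \<open>O2\<close>, so it is part of the
  inductive claim that all leaves have it.
\<close>
definition constructible :: "'a set \<Rightarrow> 'a set set \<Rightarrow> 'a set \<Rightarrow> bool" where
  "constructible V E A \<longleftrightarrow> (\<exists>SB SC. ((V, E), (A, SB, SC)) \<in> family_T \<and>
     (\<forall>u\<in>V. \<forall>w. nbrs E u = {w} \<longrightarrow> u \<in> SB))"

text \<open>
  The induction step for constructibility: the assumption \<open>smaller\<close> is the induction hypothesis for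
  the subtrees of the given tree.
\<close>
locale prunable_tree =
  fixes V :: "'a set" and E :: "'a set set" and A :: "'a set" and F :: "'a set set"
  assumes tree: "graph_tree V E" and alt: "alternating V E A F"
    and smaller: "\<And>V'. V' \<subset> V \<Longrightarrow> graph_tree V' (induced E V') \<Longrightarrow>
      alternating V' (induced E V') (A \<inter> V') (induced F V') \<Longrightarrow> 2 \<le> card V' \<Longrightarrow>
      constructible V' (induced E V') (A \<inter> V')"
begin

lemma sg: "simple_graph V E" and ac: "acyclic_graph V E" and conn: "graph_connected V E"
  using tree by (auto simp: graph_tree_def acyclic_graph_def)

lemma finV: "finite V" using sg by (simp add: simple_graph_def)

lemma covered: "{x, y} \<in> E \<Longrightarrow> x \<in> A \<or> y \<in> A"
  using alt unfolding alternating_def by (metis Int_insert_left_if0 Int_empty_left)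

lemma F_edge: "{x, y} \<in> F \<Longrightarrow> {x, y} \<in> E"
  using alt by (auto simp: alternating_def)

lemma F_independent: "{x, y} \<in> F \<Longrightarrow> x \<in> A \<Longrightarrow> y \<notin> A"
  using alt by (auto simp: alternating_def)

lemma F_degree: "a \<in> A \<Longrightarrow> card (nbrs F a) = 2" "card (nbrs F v) \<le> 2"
  using alt by (auto simp: alternating_def)

lemma finite_nbrs: "finite (nbrs E v)" "finite (nbrs F v)" "nbrs F v \<subseteq> nbrs E v"
proof -
  show "finite (nbrs E v)" using nbrs_subset[OF sg] finV by (rule finite_subset)
  show "nbrs F v \<subseteq> nbrs E v" using F_edge by (auto simp: nbrs_def)
  then show "finite (nbrs F v)" using \<open>finite (nbrs E v)\<close> by (rule finite_subset)
qed

lemma leaf_not_A: "nbrs E x = {y} \<Longrightarrow> x \<notin> A"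
  using card_mono[OF finite_nbrs(1,3), of x] F_degree(1)[of x] by auto

lemma F_other_nbr:
  assumes "a \<in> A"
  obtains w where "{a, w} \<in> F" and "w \<noteq> u"
proof -
  have "card (nbrs F a) \<le> card {u}" if "nbrs F a \<subseteq> {u}" using that by (intro card_mono) auto
  then have "\<not> nbrs F a \<subseteq> {u}" using F_degree(1)[OF assms] by auto
  then show ?thesis using that by (auto simp: nbrs_def)
qed

text \<open>
  Passing to the subtree on \<open>V'\<close>, which is connected to the rest only at \<open>v\<close>.  The alternating
  structure is inherited because a vertex of \<open>A\<close> in \<open>V'\<close> loses no edge of \<open>F\<close>; vertices outside \<open>A\<close> may
  lose some.  The vertex \<open>w\<close> guarantees that the subtree has two vertices.  A leaf of the
  tree in \<open>V'\<close> is also a leaf of the subtree and differs from \<open>v\<close>, which has neighbours on both sides;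
  so it keeps its status \<open>B\<close> when an operation changes the status of \<open>v\<close>.
\<close>
lemma prune:
  assumes sub: "V' \<subseteq> V" and v: "v \<in> V'" and w: "w \<in> V'" "w \<noteq> v" and u: "{v, u} \<in> E" "u \<notin> V'"
    and cross: "\<And>x y. {x, y} \<in> E \<Longrightarrow> x \<in> V' \<Longrightarrow> y \<notin> V' \<Longrightarrow> x = v"
    and crossF: "\<And>y. {v, y} \<in> F \<Longrightarrow> y \<notin> V' \<Longrightarrow> v \<notin> A"
  obtains SB SC where "((V', induced E V'), (A \<inter> V', SB, SC)) \<in> family_T"
    and "\<And>x y. x \<in> V' \<Longrightarrow> nbrs E x = {y} \<Longrightarrow> x \<in> SB \<and> x \<noteq> v"
    and "\<And>z. nbrs E v \<inter> V' = {z} \<Longrightarrow> v \<in> SB"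
proof -
  let ?E = "induced E V'" and ?F = "induced F V'"
  have T': "graph_tree V' ?E" using tree_prune[OF tree sub v cross] .
  have nb: "nbrs ?E x = nbrs E x \<inter> V'" "nbrs ?F x = nbrs F x \<inter> V'" if "x \<in> V'" for x
    using that by (auto simp: nbrs_def induced_def)
  have FA: "nbrs ?F a = nbrs F a" if "a \<in> A \<inter> V'" for a
  proof -
    have "y \<in> V'" if "{a, y} \<in> F" for y
      using cross[OF F_edge[OF that]] crossF[of y] that \<open>a \<in> A \<inter> V'\<close> by blast
    then show ?thesis using nb(2)[of a] that by (auto simp: nbrs_def)
  qed
  have "card (nbrs ?F x) \<le> 2" for x
  proof -
    have "card (nbrs ?F x) \<le> card (nbrs F x)"
      by (rule card_mono[OF finite_nbrs(2)]) (auto simp: nbrs_def induced_def)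
    with F_degree(2)[of x] show ?thesis by simp
  qed
  moreover have "e \<inter> (A \<inter> V') \<noteq> {}" if "e \<in> ?E" for e
    using that alt unfolding alternating_def induced_def by blast
  moreover have "?F \<subseteq> ?E" using alt unfolding alternating_def induced_def by blast
  moreover have "y \<notin> A \<inter> V'" if "{x, y} \<in> ?F" "x \<in> A \<inter> V'" for x y
    using that F_independent by (auto simp: induced_def)
  ultimately have alt': "alternating V' ?E (A \<inter> V') ?F"
    unfolding alternating_def using FA F_degree(1) by simp
  have card: "2 \<le> card V'"
    using card_mono[of V' "{v, w}"] finite_subset[OF sub finV] v w by auto
  have "u \<in> V" using edge_ends[OF sg u(1)] by simp
  with u sub have "V' \<subset> V" by auto
  then obtain SB SC where fam: "((V', ?E), (A \<inter> V', SB, SC)) \<in> family_T"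
    and leaf: "\<And>x y. x \<in> V' \<Longrightarrow> nbrs ?E x = {y} \<Longrightarrow> x \<in> SB"
    using smaller[OF _ T' alt' card] unfolding constructible_def by blast
  have inner: "nbrs E v \<inter> V' \<noteq> {}"
    using connected_nbr[of V' ?E v w] T' v w nb by (auto simp: graph_tree_def)
  show ?thesis
  proof (rule that[OF fam])
    fix x y assume x: "x \<in> V'" "nbrs E x = {y}"
    have ne: "x \<noteq> v"
    proof
      assume "x = v"
      then have "nbrs E v = {u}" using x(2) u(1) by (auto simp: nbrs_def)
      with inner u(2) show False by auto
    qed
    moreover have "nbrs E x \<subseteq> V'" using ne cross x(1) by (auto simp: nbrs_def)
    ultimately show "x \<in> SB \<and> x \<noteq> v" using leaf[OF x(1)] nb(1)[OF x(1)] x(2) by auto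
  next
    fix z assume "nbrs E v \<inter> V' = {z}"
    then show "v \<in> SB" using leaf[OF v] nb(1)[OF v] by simp
  qed
qed

lemma end_nbrs_leaves:
  assumes l: "longest_path V E (x0 # x1 # x2 # r)" and y: "{x1, y} \<in> E" "y \<noteq> x2"
  shows "nbrs E y = {x1}"
proof -
  have p: "graph_path V E (x1 # x2 # r)" using l by (simp add: longest_path_def graph_path_Cons)
  have "y \<notin> set (x1 # x2 # r)"
    using no_chord[OF ac p y(1)] y(2) edge_ends[OF sg y(1)] by auto
  then have "graph_path V E (y # x1 # x2 # r)"
    using p y edge_ends[OF sg y(1)] by (simp add: graph_path_Cons insert_commute)
  then have "longest_path V E (y # x1 # x2 # r)" using l by (simp add: longest_path_def)
  then show ?thesis by (rule longest_path_end[OF ac sg])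
qed

text \<open>
  The lemmas \<open>attach_leaf\<close>, \<open>attach_P3\<close>, \<open>attach_P2\<close> and \<open>attach_P5\<close> undo the operations \<open>O1\<close>, \<open>O3\<close>,
  \<open>O2\<close> and \<open>O4\<close>, respectively.
\<close>
lemma attach_leaf:
  assumes u: "nbrs E u = {v}" "{v, u} \<notin> F"
  shows "constructible V E A"
proof -
  define V' where "V' = V - {u}"
  have uv: "{v, u} \<in> E" using u(1) by (auto simp: nbrs_def insert_commute)
  note ends = edge_ends[OF sg uv]
  have uA: "u \<notin> A" using leaf_not_A[OF u(1)] .
  then have vA: "v \<in> A" using covered[OF uv] by simp
  obtain w where w: "{v, w} \<in> F" "w \<noteq> u" using F_other_nbr[OF vA] by blast
  obtain SB SC where fam: "((V', induced E V'), (A \<inter> V', SB, SC)) \<in> family_T"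
    and leaf: "\<And>x y. x \<in> V' \<Longrightarrow> nbrs E x = {y} \<Longrightarrow> x \<in> SB \<and> x \<noteq> v"
  proof (rule prune[of V' v w u])
    show "V' \<subseteq> V" "v \<in> V'" "u \<notin> V'" using ends by (auto simp: V'_def)
    show "w \<in> V'" "w \<noteq> v" using edge_ends[OF sg F_edge[OF w(1)]] w(2) by (auto simp: V'_def)
    show "x = v" if "{x, y} \<in> E" "x \<in> V'" "y \<notin> V'" for x y
    proof -
      have "y = u" using that edge_ends[OF sg that(1)] by (auto simp: V'_def)
      then have "x \<in> nbrs E u" using that(1) by (simp add: nbrs_def insert_commute)
      then show ?thesis using u(1) by simp
    qed
    show "v \<notin> A" if "{v, y} \<in> F" "y \<notin> V'" for y
      using that u(2) edge_ends[OF sg F_edge[OF that(1)]] by (auto simp: V'_def)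
  qed (use uv in auto)
  have "((V' \<union> {u}, induced E V' \<union> {{v, u}}), (A \<inter> V', SB \<union> {u}, SC)) \<in> family_T"
    using fam by (rule family_T.O1) (use vA ends in \<open>auto simp: V'_def\<close>)
  moreover have "V' \<union> {u} = V" "A \<inter> V' = A"
    using ends uA alt by (auto simp: V'_def alternating_def)
  moreover have "induced E V' \<union> {{v, u}} = E"
    using edges_split[OF sg, of "{u}"] by (simp add: V'_def u(1) insert_commute)
  ultimately have "((V, E), (A, SB \<union> {u}, SC)) \<in> family_T" by simp
  moreover have "\<forall>x\<in>V. \<forall>y. nbrs E x = {y} \<longrightarrow> x \<in> SB \<union> {u}" using leaf by (auto simp: V'_def)
  ultimately show ?thesis unfolding constructible_def by blast
qed

lemma attach_P3:
  assumes nb: "nbrs E x0 = {x1}" "nbrs E x0' = {x1}" "nbrs E x1 = {x0, x0', x2}"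
    and ne: "x0 \<noteq> x0'" "x2 \<noteq> x0" "x2 \<noteq> x0'" and nF: "{x1, x2} \<notin> F"
    and w: "{x2, w} \<in> E" "w \<noteq> x1"
  shows "constructible V E A"
proof -
  let ?W = "{x0, x0', x1}"
  define V' where "V' = V - ?W"
  have E: "{x1, x0} \<in> E" "{x1, x0'} \<in> E" "{x1, x2} \<in> E" using nb(3) by (auto simp: nbrs_def)
  note ends = edge_ends[OF sg E(1)] edge_ends[OF sg E(2)] edge_ends[OF sg E(3)] edge_ends[OF sg w(1)]
  have x0A: "x0 \<notin> A" "x0' \<notin> A" using leaf_not_A nb by blast+
  then have x1A: "x1 \<in> A" using covered[OF E(1)] by simp
  have nb': "y \<in> nbrs E x" if "{x, y} \<in> E" for x y using that by (simp add: nbrs_def)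
  have out: "x = x2 \<and> y = x1" if "{x, y} \<in> E" "x \<in> V'" "y \<notin> V'" for x y
  proof -
    have "x \<in> nbrs E y" using nb'[OF that(1)] nbrs_sym by metis
    moreover have "y \<in> ?W" using that edge_ends[OF sg that(1)] by (auto simp: V'_def)
    ultimately show ?thesis using that(2) nb by (auto simp: V'_def)
  qed
  have wW: "w \<in> V'"
  proof -
    have "x2 \<in> nbrs E w" using nb'[OF w(1)] nbrs_sym by metis
    moreover have "x2 \<noteq> x1" using ends(9) by simp
    ultimately have "w \<noteq> x0" "w \<noteq> x0'" using nb(1,2) by auto
    then show ?thesis using w(2) ends(11) by (simp add: V'_def)
  qed
  obtain SB SC where fam: "((V', induced E V'), (A \<inter> V', SB, SC)) \<in> family_T"
    and leaf: "\<And>x y. x \<in> V' \<Longrightarrow> nbrs E x = {y} \<Longrightarrow> x \<in> SB \<and> x \<noteq> x2"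
  proof (rule prune[of V' x2 w x1])
    show "V' \<subseteq> V" "x2 \<in> V'" "x1 \<notin> V'" "w \<in> V'" "w \<noteq> x2" "{x2, x1} \<in> E"
      using ends ne wW E(3) by (auto simp: V'_def insert_commute)
    show "x2 \<notin> A" if "{x2, y} \<in> F" "y \<notin> V'" for y
      using out[OF F_edge[OF that(1)] _ that(2)] that(1) nF ends ne
      by (auto simp: V'_def insert_commute)
  qed (use out in blast)+
  have "((V' \<union> {x0, x1, x0'}, induced E V' \<union> {{x2, x1}, {x0, x1}, {x1, x0'}}),
      (A \<inter> V' \<union> {x1}, SB - {x2} \<union> {x0, x0'}, if x2 \<in> SB then SC \<union> {x2} else SC)) \<in> family_T"
    using fam by (rule family_T.O3) (use ends ne in \<open>auto simp: V'_def\<close>)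
  moreover have "V' \<union> {x0, x1, x0'} = V" "A \<inter> V' \<union> {x1} = A"
    using ends x0A x1A alt by (auto simp: V'_def alternating_def)
  moreover have "induced E V' \<union> {{x2, x1}, {x0, x1}, {x1, x0'}} = E"
    using edges_split[OF sg, of ?W] by (simp add: V'_def nb insert_commute)
  ultimately have "((V, E), (A, SB - {x2} \<union> {x0, x0'}, if x2 \<in> SB then SC \<union> {x2} else SC)) \<in> family_T"
    by metis
  moreover have "x \<in> SB - {x2} \<union> {x0, x0'}" if "x \<in> V" "nbrs E x = {y}" for x y
    using leaf[of x y] that nb(3) ne by (cases "x = x1") (auto simp: V'_def)
  ultimately show ?thesis unfolding constructible_def by blast
qed

text \<open>
  Here the connecting edge may belong to \<open>F\<close>, which does no harm since \<open>x2\<close> is outside \<open>A\<close>.  After the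
  removal \<open>x2\<close> is a leaf, as \<open>O2\<close> requires.
\<close>
lemma attach_P2:
  assumes nb: "nbrs E x0 = {x1}" "nbrs E x1 = {x0, x2}" "nbrs E x2 = {x1, z}"
    and ne: "x2 \<noteq> x0" "x1 \<noteq> z" and x2A: "x2 \<notin> A"
  shows "constructible V E A"
proof -
  let ?W = "{x0, x1}"
  define V' where "V' = V - ?W"
  have E: "{x1, x0} \<in> E" "{x1, x2} \<in> E" "{x2, z} \<in> E" using nb by (auto simp: nbrs_def)
  note ends = edge_ends[OF sg E(1)] edge_ends[OF sg E(2)] edge_ends[OF sg E(3)]
  have x0A: "x0 \<notin> A" using leaf_not_A nb by blast
  then have x1A: "x1 \<in> A" using covered[OF E(1)] by simp
  have nb': "y \<in> nbrs E x" if "{x, y} \<in> E" for x y using that by (simp add: nbrs_def)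
  have out: "x = x2 \<and> y = x1" if "{x, y} \<in> E" "x \<in> V'" "y \<notin> V'" for x y
  proof -
    have "x \<in> nbrs E y" using nb'[OF that(1)] nbrs_sym by metis
    moreover have "y \<in> ?W" using that edge_ends[OF sg that(1)] by (auto simp: V'_def)
    ultimately show ?thesis using that(2) nb by (auto simp: V'_def)
  qed
  have zV: "z \<in> V'"
  proof -
    have "x2 \<in> nbrs E z" using nb'[OF E(3)] nbrs_sym by metis
    then show ?thesis using nb ne ends by (auto simp: V'_def)
  qed
  obtain SB SC where fam: "((V', induced E V'), (A \<inter> V', SB, SC)) \<in> family_T"
    and leaf: "\<And>x y. x \<in> V' \<Longrightarrow> nbrs E x = {y} \<Longrightarrow> x \<in> SB \<and> x \<noteq> x2"
    and end': "\<And>z. nbrs E x2 \<inter> V' = {z} \<Longrightarrow> x2 \<in> SB"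
  proof (rule prune[of V' x2 z x1])
    show "V' \<subseteq> V" "x2 \<in> V'" "x1 \<notin> V'" "z \<in> V'" "z \<noteq> x2" "{x2, x1} \<in> E"
      using ends ne zV E(2) by (auto simp: V'_def insert_commute)
  qed (use out x2A in blast)+
  have "x2 \<in> SB" by (rule end'[of z]) (use zV nb in \<open>auto simp: V'_def\<close>)
  then have "((V' \<union> {x1, x0}, induced E V' \<union> {{x2, x1}, {x1, x0}}),
      (A \<inter> V' \<union> {x1}, SB - {x2} \<union> {x0}, SC \<union> {x2})) \<in> family_T"
    by (rule family_T.O2[OF fam]) (use ends in \<open>auto simp: V'_def\<close>)
  moreover have "V' \<union> {x1, x0} = V" "A \<inter> V' \<union> {x1} = A"
    using ends x0A x1A alt by (auto simp: V'_def alternating_def)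
  moreover have "induced E V' \<union> {{x2, x1}, {x1, x0}} = E"
    using edges_split[OF sg, of ?W] by (simp add: V'_def nb insert_commute)
  ultimately have "((V, E), (A, SB - {x2} \<union> {x0}, SC \<union> {x2})) \<in> family_T" by metis
  moreover have "x \<in> SB - {x2} \<union> {x0}" if "x \<in> V" "nbrs E x = {y}" for x y
    using leaf[of x y] that nb(2) ne by (cases "x = x1") (auto simp: V'_def)
  ultimately show ?thesis unfolding constructible_def by blast
qed

lemma attach_P5:
  assumes nb: "nbrs E x0 = {x1}" "nbrs E x1 = {x0, x2}" "nbrs E y0 = {y1}" "nbrs E y1 = {y0, x2}"
    "nbrs E x2 = {x1, y1, x3}"
    and dist: "distinct [x0, x1, x2, x3, y0, y1]" and x2A: "x2 \<notin> A" and nF: "{x2, x3} \<notin> F"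
  shows "constructible V E A"
proof -
  let ?W = "{x0, x1, x2, y0, y1}"
  define V' where "V' = V - ?W"
  have E: "{x1, x0} \<in> E" "{x1, x2} \<in> E" "{y1, x2} \<in> E" "{y1, y0} \<in> E" "{x2, x3} \<in> E"
    using nb by (auto simp: nbrs_def)
  note ends = edge_ends(1,2)[OF sg E(1)] edge_ends(1,2)[OF sg E(2)] edge_ends(1,2)[OF sg E(3)]
    edge_ends(1,2)[OF sg E(4)] edge_ends(1,2)[OF sg E(5)]
  have nA: "x0 \<notin> A" "y0 \<notin> A" using leaf_not_A nb by blast+
  have inA: "x1 \<in> A" "y1 \<in> A" "x3 \<in> A"
    using covered[OF E(1)] covered[OF E(4)] covered[OF E(5)] nA x2A by auto
  have nb': "y \<in> nbrs E x" if "{x, y} \<in> E" for x y using that by (simp add: nbrs_def)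
  have out: "x = x3 \<and> y = x2" if "{x, y} \<in> E" "x \<in> V'" "y \<notin> V'" for x y
  proof -
    have "x \<in> nbrs E y" using nb'[OF that(1)] nbrs_sym by metis
    moreover have "y \<in> ?W" using that edge_ends[OF sg that(1)] by (auto simp: V'_def)
    ultimately show ?thesis using that(2) nb by (auto simp: V'_def)
  qed
  have x3V: "x3 \<in> V'" using ends dist by (auto simp: V'_def)
  obtain w where w: "{x3, w} \<in> F" "w \<noteq> x2" using F_other_nbr[OF inA(3)] by blast
  have wV: "w \<in> V'" "w \<noteq> x3" using out[OF F_edge[OF w(1)] x3V] w(2) edge_ends[OF sg F_edge[OF w(1)]] by auto
  obtain SB SC where fam: "((V', induced E V'), (A \<inter> V', SB, SC)) \<in> family_T"
    and leaf: "\<And>x y. x \<in> V' \<Longrightarrow> nbrs E x = {y} \<Longrightarrow> x \<in> SB \<and> x \<noteq> x3"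
  proof (rule prune[of V' x3 w x2])
    show "V' \<subseteq> V" "x2 \<notin> V'" "{x3, x2} \<in> E" using E(5) by (auto simp: V'_def insert_commute)
    show "x3 \<notin> A" if "{x3, y} \<in> F" "y \<notin> V'" for y
      using out[OF F_edge[OF that(1)] x3V that(2)] that(1) nF by (auto simp: insert_commute)
  qed (use out x3V wV in blast)+
  have "((V' \<union> {x0, x1, x2, y1, y0}, induced E V' \<union> {{x3, x2}, {x0, x1}, {x1, x2}, {x2, y1}, {y1, y0}}),
      (A \<inter> V' \<union> {x1, y1}, SB \<union> {x0, y0}, SC \<union> {x2})) \<in> family_T"
    using fam by (rule family_T.O4) (use inA x3V dist in \<open>auto simp: V'_def\<close>)
  moreover have "V' \<union> {x0, x1, x2, y1, y0} = V" "A \<inter> V' \<union> {x1, y1} = A"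
    using ends nA x2A inA alt by (auto simp: V'_def alternating_def)
  moreover have "induced E V' \<union> {{x3, x2}, {x0, x1}, {x1, x2}, {x2, y1}, {y1, y0}} = E"
    using edges_split[OF sg, of ?W] by (simp add: V'_def nb insert_commute)
  ultimately have "((V, E), (A, SB \<union> {x0, y0}, SC \<union> {x2})) \<in> family_T" by metis
  moreover have "x \<in> SB \<union> {x0, y0}" if "x \<in> V" "nbrs E x = {y}" for x y
  proof -
    have "x \<notin> {x1, x2, y1}" using that nb dist by auto
    then show ?thesis using leaf[of x y] that by (auto simp: V'_def)
  qed
  ultimately show ?thesis unfolding constructible_def by blast
qed

text \<open>
  As the tree is not constructible, neither \<open>O1\<close> nor \<open>O3\<close> can be undone at \<open>x1\<close>.  So all leaves at \<open>x1\<close>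
  are joined to it by \<open>F\<close>, and so is \<open>x2\<close>; since \<open>x1\<close> has only two edges in \<open>F\<close>, the only leaf is \<open>x0\<close>.
\<close>
lemma longest_path_end_pair:
  assumes l: "longest_path V E (x0 # x1 # x2 # r)" and nc: "\<not> constructible V E A"
  shows "nbrs E x1 = {x0, x2}" and "{x1, x2} \<in> F"
proof -
  have nb0: "nbrs E x0 = {x1}" using longest_path_end[OF ac sg l] .
  have E: "{x1, x0} \<in> E" "{x1, x2} \<in> E" and ne: "x0 \<noteq> x2"
    using l by (auto simp: longest_path_def graph_path_Cons insert_commute)
  have leafF: "{x1, y} \<in> F" if "nbrs E y = {x1}" for y using attach_leaf[OF that] nc by blast
  have otherF: "{x1, y} \<in> F" if "{x1, y} \<in> E" "y \<noteq> x2" for y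
    using leafF end_nbrs_leaves[OF l that] .
  have x1A: "x1 \<in> A" using covered[OF E(1)] leaf_not_A[OF nb0] by simp
  have card: "card (nbrs F x1) = 2" using F_degree(1)[OF x1A] .
  show x12: "{x1, x2} \<in> F"
  proof (rule ccontr)
    assume nF: "{x1, x2} \<notin> F"
    obtain x0' where x0': "{x1, x0'} \<in> F" "x0' \<noteq> x0" using F_other_nbr[OF x1A] by blast
    then have ne': "x0' \<noteq> x2" using nF by auto
    have "{x0, x0'} \<subseteq> nbrs F x1" using otherF[OF E(1) ne] x0' by (simp add: nbrs_def)
    then have "nbrs F x1 = {x0, x0'}"
      using card x0'(2) finite_nbrs(2) by (metis card_2_iff card_subset_eq)
    then have "nbrs E x1 = {x0, x0', x2}"
      using otherF E F_edge[OF x0'(1)] by (auto simp: nbrs_def)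
    moreover have nb0': "nbrs E x0' = {x1}" using end_nbrs_leaves[OF l F_edge[OF x0'(1)] ne'] .
    moreover have "nbrs E x2 \<noteq> {x1}" using leafF nF by blast
    then obtain w where "{x2, w} \<in> E" "w \<noteq> x1" using E(2) by (auto simp: nbrs_def insert_commute)
    ultimately show False using attach_P3[of x0 x1 x0' x2 w] nb0 nc ne ne' nF x0'(2) by auto
  qed
  have "{x0, x2} \<subseteq> nbrs F x1" using otherF[OF E(1) ne] x12 by (simp add: nbrs_def)
  then have "nbrs F x1 = {x0, x2}" using card ne finite_nbrs(2) by (metis card_2_iff card_subset_eq)
  then show "nbrs E x1 = {x0, x2}" using otherF E by (auto simp: nbrs_def)
qed

text \<open>
  Every neighbour \<open>y\<close> of \<open>x2\<close> off the tail of the path lies in \<open>A\<close>, hence has a second neighbour \<open>z\<close>, and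
  replacing \<open>x0, x1\<close> by \<open>z, y\<close> gives another longest path, to which \<open>longest_path_end_pair\<close> applies.
\<close>
lemma longest_path_sibling:
  assumes l: "longest_path V E (x0 # x1 # x2 # r)" and nc: "\<not> constructible V E A"
    and y: "{x2, y} \<in> E" "r \<noteq> [] \<longrightarrow> y \<noteq> hd r"
  obtains z where "nbrs E z = {y}" and "nbrs E y = {z, x2}" and "{y, x2} \<in> F" and "z \<noteq> x2"
proof -
  have p: "graph_path V E (x2 # r)" using l by (simp add: longest_path_def graph_path_Cons)
  have "y \<notin> set r" using no_chord[OF ac, of x2 "hd r" "tl r" y] p y by (cases r) auto
  then have yp: "graph_path V E (y # x2 # r)"
    using p y(1) edge_ends[OF sg y(1)] by (auto simp: graph_path_Cons insert_commute)
  have "{x2, x1} \<in> F" using longest_path_end_pair(2)[OF l nc] by (simp add: insert_commute)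
  moreover have "x1 \<in> A"
    using covered[of x0 x1] leaf_not_A[OF longest_path_end[OF ac sg l]] l
    by (auto simp: longest_path_def graph_path_Cons)
  ultimately have "x2 \<notin> A" using F_independent by blast
  then have "y \<in> A" using covered[OF y(1)] by simp
  then obtain z where z: "{y, z} \<in> F" "z \<noteq> x2" using F_other_nbr by blast
  have zE: "{y, z} \<in> E" using F_edge[OF z(1)] .
  have "z \<notin> set (y # x2 # r)" using no_chord[OF ac yp zE] z(2) edge_ends[OF sg zE] by auto
  then have "graph_path V E (z # y # x2 # r)"
    using yp zE edge_ends[OF sg zE] by (simp add: graph_path_Cons insert_commute)
  then have lz: "longest_path V E (z # y # x2 # r)" using l by (simp add: longest_path_def)
  show ?thesis
    using that longest_path_end[OF ac sg lz] longest_path_end_pair[OF lz nc] z(2) by blast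
qed

text \<open>
  After \<open>longest_path_end_pair\<close> only the degree of \<open>x2\<close> matters: degree one means that the tree is the
  path on three vertices, degree two is handled by \<open>attach_P2\<close>, and larger degree by \<open>attach_P5\<close>.
\<close>
lemma prunable_constructible:
  assumes "2 \<le> card V"
  shows "constructible V E A"
proof (rule ccontr)
  assume nc: "\<not> constructible V E A"
  obtain a b where ab: "a \<in> V" "b \<in> V" "a \<noteq> b"
    using assms by (metis card_2_iff' card_le_Suc0_iff_eq finV not_less_eq_eq numeral_2_eq_2)
  then obtain c where "{a, c} \<in> E" using connected_nbr[OF conn ab] by (auto simp: nbrs_def)
  then obtain d where d: "d \<in> A" using covered by blast
  \<comment> \<open>A vertex of \<open>A\<close> with its two neighbours in \<open>F\<close> shows that a longest path has three vertices.\<close>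
  obtain e where e: "{d, e} \<in> F" using F_other_nbr[OF d] by blast
  obtain f where f: "{d, f} \<in> F" "f \<noteq> e" using F_other_nbr[OF d] by blast
  have "graph_path V E [e, d, f]"
    using e f F_edge edge_ends[OF sg F_edge[OF e]] edge_ends[OF sg F_edge[OF f(1)]]
    by (auto simp: graph_path_def insert_commute)
  then obtain xs where xs: "longest_path V E xs" "length [e, d, f] \<le> length xs"
    using longest_path_exists[OF finV] by blast
  then obtain x0 x1 x2 r where "xs = x0 # x1 # x2 # r" by (auto simp: Suc_le_length_iff numeral_3_eq_3)
  with xs(1) have l: "longest_path V E (x0 # x1 # x2 # r)" by simp
  have p: "graph_path V E (x0 # x1 # x2 # r)" using l by (simp add: longest_path_def)
  have d: "x0 \<noteq> x1" "x0 \<noteq> x2" "x1 \<noteq> x2" using p by (auto simp: graph_path_def)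
  have nb0: "nbrs E x0 = {x1}" using longest_path_end[OF ac sg l] .
  note nb1 = longest_path_end_pair[OF l nc]
  have x1A: "x1 \<in> A" using covered[of x0 x1] leaf_not_A[OF nb0] p by (auto simp: graph_path_Cons)
  have x2A: "x2 \<notin> A" using F_independent[OF nb1(2) x1A] .
  have x1N: "x1 \<in> nbrs E x2" "x1 \<in> nbrs F x2" using nb1 F_edge[OF nb1(2)] by (auto simp: nbrs_def insert_commute)
  show False
  proof (cases "nbrs E x2 = {x1}")
    case True
    have "V \<subseteq> {x0, x1, x2}"
    proof (rule connected_closed[OF conn, of x0])
      show "x0 \<in> V" using p by (simp add: graph_path_def)
      fix x y assume "{x, y} \<in> E" "x \<in> {x0, x1, x2}"
      then show "y \<in> {x0, x1, x2}" using nb0 nb1(1) True by (auto simp: nbrs_def)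
    qed simp
    then have V: "V = {x0, x1, x2}" using p by (auto simp: graph_path_def)
    have "A = {x1}" using alt V x1A x2A leaf_not_A[OF nb0] by (auto simp: alternating_def)
    moreover have "induced E {} = {}" using sg by (auto simp: induced_def simple_graph_def)
    then have "E = {{x0, x1}, {x1, x2}}"
      using edges_split[OF sg, of V] by (simp add: V nb0 nb1(1) True insert_commute)
    ultimately have "((V, E), (A, {x0, x2}, {})) \<in> family_T"
      using family_T.base[of x0 x1 x2] d V by simp
    moreover have "\<forall>u\<in>V. \<forall>w. nbrs E u = {w} \<longrightarrow> u \<in> {x0, x2}" using V nb1(1) d by auto
    ultimately show False using nc unfolding constructible_def by blast
  next
    case False
    then obtain z where z: "{x2, z} \<in> E" "z \<noteq> x1" using x1N by (auto simp: nbrs_def)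
    show False
    proof (cases "nbrs E x2 = {x1, z}")
      case True
      then show False using attach_P2[OF nb0 nb1(1) True] d z x2A nc by auto
    next
      case False
      have sibF: "{x2, y} \<in> F" if "{x2, y} \<in> E" "r \<noteq> [] \<longrightarrow> y \<noteq> hd r" for y
        using longest_path_sibling[OF l nc that] by (metis insert_commute)
      obtain z' where z': "{x2, z'} \<in> E" "z' \<noteq> x1" "z' \<noteq> z" using False z x1N by (auto simp: nbrs_def)
      \<comment> \<open>Besides \<open>x1\<close>, only one further neighbour of \<open>x2\<close> can be joined to it by \<open>F\<close>.\<close>
      have no3: False if "{x2, s} \<in> F" "{x2, t} \<in> F" "s \<noteq> t" "s \<noteq> x1" "t \<noteq> x1" for s t
      proof -
        have "card {x1, s, t} \<le> card (nbrs F x2)"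
          using that x1N(2) by (intro card_mono[OF finite_nbrs(2)]) (auto simp: nbrs_def)
        then show False using that F_degree(2)[of x2] by auto
      qed
      \<comment> \<open>Without \<open>x3\<close> the edges to \<open>z\<close> and \<open>z'\<close> would both be in \<open>F\<close>.\<close>
      have r: "r \<noteq> []" using no3[OF sibF sibF] z z' by blast
      define x3 where "x3 = hd r"
      have x3: "x3 \<notin> {x0, x1, x2}" "{x2, x3} \<in> E"
        using p r unfolding x3_def by (cases r; auto simp: graph_path_Cons)+
      obtain y where y: "{x2, y} \<in> E" "y \<noteq> x1" "y \<noteq> x3" using z z' by metis
      then have yF: "{x2, y} \<in> F" using sibF by (simp add: x3_def)
      obtain y0 where y0: "nbrs E y0 = {y}" "nbrs E y = {y0, x2}" "y0 \<noteq> x2"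
        using longest_path_sibling[OF l nc y(1)] y(3) unfolding x3_def by metis
      have "t \<in> {x1, y, x3}" if "{x2, t} \<in> E" for t
        using no3[OF sibF[OF that] yF] that y(2) by (auto simp: x3_def)
      then have nb2: "nbrs E x2 = {x1, y, x3}" using x1N y(1) x3(2) by (auto simp: nbrs_def)
      have nF: "{x2, x3} \<notin> F" using no3[OF _ yF] y x3(1) by blast
      have "y \<noteq> x0" "y0 \<noteq> x0" "y0 \<noteq> x1" "y0 \<noteq> y" "y \<noteq> x2"
      proof -
        show "y \<noteq> x0" using nb0 y0(2) d by auto
        show "y0 \<noteq> x0" using nb0 y0(1) y(2) by auto
        show "y0 \<noteq> x1" using nb1(1) y0(1) d by auto
        show "y0 \<noteq> y" using y0(1,2,3) by auto
        show "y \<noteq> x2" using edge_ends(3)[OF sg y(1)] by simp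
      qed
      moreover have "y0 \<noteq> x3"
      proof
        assume "y0 = x3"
        then have "x2 \<in> nbrs E y0" using x3(2) by (simp add: nbrs_def insert_commute)
        then show False using y0(1) \<open>y \<noteq> x2\<close> by simp
      qed
      ultimately have "distinct [x0, x1, x2, x3, y0, y]" using d x3(1) y y0(3) by auto
      then show False using attach_P5[OF nb0 nb1(1) y0(1,2) nb2 _ x2A nF] nc by blast
    qed
  qed
qed

end

lemma alternating_tree_constructible:
  assumes "graph_tree V E" and "alternating V E A F" and "2 \<le> card V"
  shows "constructible V E A"
  using assms
proof (induction "card V" arbitrary: V E A F rule: less_induct)
  case less
  have fin: "finite V" using less.prems(1) by (simp add: graph_tree_def simple_graph_def)
  interpret prunable_tree V E A F
    using less.prems(1,2) less.hyps[OF psubset_card_mono[OF fin]] by unfold_locales auto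
  show ?case using prunable_constructible less.prems(3) .
qed

section \<open>Trees in the family\<close>

lemma family_labeling:
  assumes "((V, E), (SA, SB, SC)) \<in> family_T"
  shows "is_labeling V (SA, SB, SC) \<and> simple_graph V E"
  using assms
proof (induction V E SA SB SC rule: family_T.induct)
  case (O1 V E SA SB SC v u1)
  then show ?case by (auto simp: simple_graph_def card_insert_if)
next
  case (O2 V E SA SB SC v u1 u2)
  then show ?case by (auto simp: simple_graph_def card_insert_if)
next
  case (O3 V E SA SB SC v u1 u2 u3)
  then show ?case by (auto simp: simple_graph_def card_insert_if)
next
  case (O4 V E SA SB SC v u1 u2 u3 u4 u5)
  then show ?case by (auto simp: simple_graph_def card_insert_if)
qed (auto simp: simple_graph_def card_insert_if)

lemma family_vertex_cover:
  assumes "((V, E), (SA, SB, SC)) \<in> family_T"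
  shows "\<forall>e\<in>E. e \<inter> SA \<noteq> {}"
  using assms
  by (induction V E SA SB SC rule: family_T.induct) auto

text \<open>This form is easier to check for a modified cover than unique existence.\<close>
lemma path_cover_alt:
  "path_cover V E P \<longleftrightarrow> (\<forall>p\<in>P. graph_path V E p) \<and>
     (\<forall>p\<in>P. \<forall>q\<in>P. p \<noteq> q \<longrightarrow> set p \<inter> set q = {}) \<and> (\<Union>p\<in>P. set p) = V"
proof (cases "(\<forall>p\<in>P. graph_path V E p) \<and> (\<forall>p\<in>P. \<forall>q\<in>P. p \<noteq> q \<longrightarrow> set p \<inter> set q = {})")
  case True
  then have sub: "set p \<subseteq> V" if "p \<in> P" for p using that by (simp add: graph_path_def)
  have "(\<forall>v\<in>V. \<exists>!p. p \<in> P \<and> v \<in> set p) \<longleftrightarrow> (\<Union>p\<in>P. set p) = V"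
  proof
    assume "\<forall>v\<in>V. \<exists>!p. p \<in> P \<and> v \<in> set p"
    then have "V \<subseteq> (\<Union>p\<in>P. set p)" by (auto dest: ex1_implies_ex)
    then show "(\<Union>p\<in>P. set p) = V" using sub by blast
  next
    assume U: "(\<Union>p\<in>P. set p) = V"
    show "\<forall>v\<in>V. \<exists>!p. p \<in> P \<and> v \<in> set p"
    proof
      fix v assume "v \<in> V"
      then obtain p where p: "p \<in> P" "v \<in> set p" using U by blast
      show "\<exists>!p. p \<in> P \<and> v \<in> set p"
      proof (rule ex1I[of _ p])
        fix q assume "q \<in> P \<and> v \<in> set q"
        then show "q = p" using True p by (meson disjoint_iff)
      qed (use p in simp)
    qed
  qed
  then show ?thesis using True by (simp add: path_cover_def)
next
  case False
  then show ?thesis unfolding path_cover_def by argo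
qed

lemma path_cover_insert:
  assumes "simple_graph V E" and P: "path_cover V E P" and p: "graph_path (V \<union> set p) E' p"
    and new: "set p \<inter> V = {}" and E: "E \<subseteq> E'"
  shows "path_cover (V \<union> set p) E' (insert p P)" and "card (insert p P) = Suc (card P)"
proof -
  have sub: "set q \<subseteq> V" "graph_path (V \<union> set p) E' q" if "q \<in> P" for q
    using P that graph_path_subgraph[of V E q "V \<union> set p" E'] E
    by (auto simp: path_cover_def graph_path_def)
  show "path_cover (V \<union> set p) E' (insert p P)"
    using P sub p new unfolding path_cover_alt by blast
  have "set p \<noteq> {}" using p by (simp add: graph_path_def)
  then have "p \<notin> P" using sub(1)[of p] new by (metis Int_absorb2)
  then show "card (insert p P) = Suc (card P)"
    using path_cover_card(1)[OF assms(1) P] by simp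
qed

lemma path_cover_extend:
  assumes "simple_graph V E" and P: "path_cover V E P" and p: "p \<in> P"
    and q: "graph_path (V \<union> W) E' q" "set q = set p \<union> W" and new: "W \<inter> V = {}" "W \<noteq> {}" and E: "E \<subseteq> E'"
  shows "path_cover (V \<union> W) E' (insert q (P - {p}))" and "card (insert q (P - {p})) = card P"
proof -
  have sub: "set r \<subseteq> V" "graph_path (V \<union> W) E' r" if "r \<in> P" for r
    using P that graph_path_subgraph[of V E r "V \<union> W" E'] E
    by (auto simp: path_cover_def graph_path_def)
  have disj: "set r \<inter> set r' = {}" if "r \<in> P" "r' \<in> P" "r \<noteq> r'" for r r'
    using P that by (auto simp: path_cover_def)
  have U: "(\<Union>r\<in>P. set r) = V" using P by (simp add: path_cover_alt)
  have "set q \<inter> set r = {}" if "r \<in> P - {p}" for r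
    using that disj[OF p, of r] sub(1)[of r] q(2) new(1) by blast
  moreover have "(\<Union>r\<in>insert q (P - {p}). set r) = V \<union> W"
    using U q(2) p by blast
  ultimately show "path_cover (V \<union> W) E' (insert q (P - {p}))"
    unfolding path_cover_alt using sub(2) q(1) disj by (auto simp: Int_commute)
  have "q \<notin> P"
  proof
    assume "q \<in> P"
    then have "W \<subseteq> V" using sub(1)[of q] q(2) by simp
    then show False using new by (metis Int_absorb2)
  qed
  then show "card (insert q (P - {p})) = card P"
    using path_cover_card(1)[OF assms(1) P] p by (simp add: card_Suc_Diff1 del: card_Diff_insert card_Diff_singleton)
qed

text \<open>
  \<open>O1\<close>, \<open>O3\<close> and \<open>O4\<close> add the new vertices as one further path, with zero, one and two vertices of
  status \<open>A\<close>.  \<open>O2\<close> prolongs a path at its end \<open>v\<close>, which is where the last conjunct is used; \<open>v\<close> then has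
  status \<open>C\<close>, being an inner vertex or, if its path was a single vertex, an end which is not used again.
\<close>
lemma family_path_cover:
  assumes "((V, E), (SA, SB, SC)) \<in> family_T"
  shows "\<exists>P. path_cover V E P \<and> card V = 2 * card SA + card P \<and>
    (\<forall>v\<in>SB. \<exists>p\<in>P. v = hd p \<or> v = last p)"
  using assms
proof (induction V E SA SB SC rule: family_T.induct)
  case (base x c y)
  have "path_cover {x, c, y} {{x, c}, {c, y}} {[x, c, y]}"
    using base by (auto simp: path_cover_alt graph_path_def)
  moreover have "card {x, c, y} = 3" using base by simp
  ultimately show ?case by (intro exI[of _ "{[x, c, y]}"]) auto
next
  case (O1 V E SA SB SC v u1)
  then obtain P where P: "path_cover V E P" "card V = 2 * card SA + card P"
    "\<forall>v\<in>SB. \<exists>p\<in>P. v = hd p \<or> v = last p" by blast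
  have sg: "simple_graph V E" using family_labeling[OF O1.hyps(1)] by simp
  note ins = path_cover_insert[OF sg P(1), of "[u1]" "E \<union> {{v, u1}}"]
  have "card (V \<union> {u1}) = Suc (card V)" using O1.hyps(3) sg by (simp add: simple_graph_def)
  then show ?case
    using ins[OF _ _ Un_upper1] O1.hyps(3) P by (intro exI[of _ "insert [u1] P"]) (auto simp: graph_path_def)
next
  case (O2 V E SA SB SC v u1 u2)
  then obtain P where P: "path_cover V E P" "card V = 2 * card SA + card P"
    "\<forall>v\<in>SB. \<exists>p\<in>P. v = hd p \<or> v = last p" by blast
  let ?E = "E \<union> {{v, u1}, {u1, u2}}"
  have lab: "is_labeling V (SA, SB, SC)" and sg: "simple_graph V E"
    using family_labeling[OF O2.hyps(1)] by simp_all
  obtain p where p: "p \<in> P" "v = hd p \<or> v = last p" using P(3) O2.hyps(2) by blast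
  have gp: "graph_path V E p" using P(1) p(1) by (simp add: path_cover_def)
  then have gp': "graph_path (V \<union> {u1, u2}) ?E p" by (rule graph_path_subgraph) auto
  have ne: "p \<noteq> []" "set p \<subseteq> V" using gp by (auto simp: graph_path_def)
  define q where "q = (if v = hd p then u2 # u1 # p else p @ [u1, u2])"
  have q: "graph_path (V \<union> {u1, u2}) ?E q"
    using gp' p(2) ne O2.hyps(3,4) unfolding q_def graph_path_def
    by (auto simp: successively_append_iff successively_Cons insert_commute)
  have setq: "set q = set p \<union> {u1, u2}" by (auto simp: q_def)
  note ext = path_cover_extend[OF sg P(1) p(1) q setq]
  have "u2 = hd q \<or> u2 = last q" by (auto simp: q_def)
  moreover have "w = hd q \<or> w = last q" if "w \<noteq> v" "w = hd p \<or> w = last p" for w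
    using that p(2) ne(1) by (auto simp: q_def)
  ultimately have ends: "\<forall>w\<in>SB - {v} \<union> {u2}. \<exists>r\<in>insert q (P - {p}). w = hd r \<or> w = last r"
    using P(3) by blast
  have "card (V \<union> {u1, u2}) = card V + 2" using O2.hyps(3,4) sg by (simp add: simple_graph_def)
  moreover have "card (SA \<union> {u1}) = Suc (card SA)"
  proof -
    have "finite SA" "u1 \<notin> SA" using lab sg O2.hyps(4) by (auto simp: simple_graph_def)
    then show ?thesis by simp
  qed
  ultimately show ?case
    using ext[OF _ _ Un_upper1] ends O2.hyps(4) P(2) by (intro exI[of _ "insert q (P - {p})"]) auto
next
  case (O3 V E SA SB SC v u1 u2 u3)
  then obtain P where P: "path_cover V E P" "card V = 2 * card SA + card P"
    "\<forall>v\<in>SB. \<exists>p\<in>P. v = hd p \<or> v = last p" by blast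
  have lab: "is_labeling V (SA, SB, SC)" and sg: "simple_graph V E"
    using family_labeling[OF O3.hyps(1)] by simp_all
  note ins = path_cover_insert[OF sg P(1), of "[u1, u2, u3]" "E \<union> {{v, u2}, {u1, u2}, {u2, u3}}"]
  have "card (V \<union> {u1, u2, u3}) = card V + 3" using O3.hyps(3,4) sg by (simp add: simple_graph_def)
  moreover have "card (SA \<union> {u2}) = Suc (card SA)"
  proof -
    have "finite SA" "u2 \<notin> SA" using lab sg O3.hyps(4) by (auto simp: simple_graph_def)
    then show ?thesis by simp
  qed
  moreover have "graph_path (V \<union> {u1, u2, u3}) (E \<union> {{v, u2}, {u1, u2}, {u2, u3}}) [u1, u2, u3]"
    using O3.hyps(3) by (auto simp: graph_path_def)
  ultimately show ?case
    using ins[OF _ _ Un_upper1] O3.hyps(4) P by (intro exI[of _ "insert [u1, u2, u3] P"]) auto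
next
  case (O4 V E SA SB SC v u1 u2 u3 u4 u5)
  then obtain P where P: "path_cover V E P" "card V = 2 * card SA + card P"
    "\<forall>v\<in>SB. \<exists>p\<in>P. v = hd p \<or> v = last p" by blast
  let ?E = "E \<union> {{v, u3}, {u1, u2}, {u2, u3}, {u3, u4}, {u4, u5}}"
  have lab: "is_labeling V (SA, SB, SC)" and sg: "simple_graph V E"
    using family_labeling[OF O4.hyps(1)] by simp_all
  note ins = path_cover_insert[OF sg P(1), of "[u1, u2, u3, u4, u5]" ?E]
  have "card (V \<union> {u1, u2, u3, u4, u5}) = card V + 5" using O4.hyps(3,4) sg by (simp add: simple_graph_def)
  moreover have "card (SA \<union> {u2, u4}) = card SA + 2"
  proof -
    have "finite SA" "u2 \<notin> SA" "u4 \<notin> SA" using lab sg O4.hyps(4) by (auto simp: simple_graph_def)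
    then show ?thesis using O4.hyps(3) by simp
  qed
  moreover have "graph_path (V \<union> {u1, u2, u3, u4, u5}) ?E [u1, u2, u3, u4, u5]"
    using O4.hyps(3) by (auto simp: graph_path_def)
  ultimately show ?case
    using ins[OF _ _ Un_upper1] O4.hyps(4) P by (intro exI[of _ "insert [u1, u2, u3, u4, u5] P"]) auto
qed

section \<open>The bound and its extremal trees\<close>
theorem theorem6:
  fixes V :: "'a set" and E :: "'a set set" and n :: nat
  assumes "graph_tree V E"
    and "card V = n"
    and "n \<ge> 3"
  shows "real (matching_number E) + 1 / 2 * real (path_cover_number V E) \<ge> real n / 2 \<and>
    (real (matching_number E) + 1 / 2 * real (path_cover_number V E) = real n / 2 \<longleftrightarrow>
      (\<exists>S. is_labeling V S \<and> ((V, E), S) \<in> family_T))"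
proof -
  have sg: "simple_graph V E" and ac: "acyclic_graph V E"
    using assms(1) by (auto simp: graph_tree_def acyclic_graph_def)
  obtain M A where M: "matching E M" and A: "A \<subseteq> V" "\<forall>e\<in>E. e \<inter> A \<noteq> {}" and "card A \<le> card M"
    using forest_vertex_cover[OF sg ac] by blast
  with matching_le[OF sg M] have cA: "card A \<le> matching_number E" by simp
  obtain P where P: "path_cover V E P" and cP: "card P = path_cover_number V E"
    by (rule path_cover_number_attained)
  have cV: "card V \<le> 2 * card A + card P" using path_cover_bound(1)[OF sg P A] .
  then have bound: "n \<le> 2 * matching_number E + path_cover_number V E"
    using cA cP assms(2) by simp
  have "n = 2 * matching_number E + path_cover_number V E \<longleftrightarrow>
      (\<exists>S. is_labeling V S \<and> ((V, E), S) \<in> family_T)"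
  proof
    assume "n = 2 * matching_number E + path_cover_number V E"
    then have "card V = 2 * card A + card P" using cV cA cP assms(2) by simp
    then obtain F where "alternating V E A F" using path_cover_alternating[OF sg P A] by blast
    then have "constructible V E A"
      using alternating_tree_constructible[OF assms(1)] assms(2,3) by simp
    then obtain SB SC where "((V, E), (A, SB, SC)) \<in> family_T" unfolding constructible_def by blast
    then show "\<exists>S. is_labeling V S \<and> ((V, E), S) \<in> family_T" using family_labeling by blast
  next
    assume "\<exists>S. is_labeling V S \<and> ((V, E), S) \<in> family_T"
    then obtain SA SB SC where S: "is_labeling V (SA, SB, SC)" "((V, E), (SA, SB, SC)) \<in> family_T"
      by (metis prod_cases3)
    have "finite SA" using S(1) sg by (auto simp: simple_graph_def)
    then have "matching_number E \<le> card SA"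
      using matching_number_le_cover[OF sg _ family_vertex_cover[OF S(2)]] by simp
    moreover obtain Q where "path_cover V E Q" "card V = 2 * card SA + card Q"
      using family_path_cover[OF S(2)] by blast
    ultimately show "n = 2 * matching_number E + path_cover_number V E"
      using bound path_cover_number_le assms(2) by fastforce
  qed
  moreover have "real (matching_number E) + 1 / 2 * real (path_cover_number V E) =
      real (2 * matching_number E + path_cover_number V E) / 2" by simp
  ultimately show ?thesis using bound by auto
qed

end
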